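(* Let $0<\alpha<1$ and let $D$ be the linear span of the functions $F_\lambda(z)=e^{-\lambda z}$ on $[0,\infty)$, $\lambda>0$. Let $$\mathbf U(F)=\int\Lambda(dz)(F(z)-F(0))^2,$$ $$\mathbf V(F)=\frac12\left[\int\Lambda(dz)\,z\int n_B(dy)(F(z+y)-F(z))^2+\int n_I(dy)(F(y)-F(0))^2\right],$$ all integrals being over $(0,\infty)$. Then for each $F\in D$, $$2\mathbf V(F)-\mathbf U(F)=\frac{\alpha}{\alpha+1}\int\Lambda(dz)z^3\int n_B(dy)\left[\frac{F(z)-F(0)}{z}-\frac{F(z+y)-F(0)}{z+y}\right]^2$$ $$+\int\Lambda(dz)z^2\int n_I(dy)\left[\frac{F(z)-F(0)}{z}-\frac{F(z+y)-F(0)}{z+y}\right]^2+\frac{1}{\alpha+1}\int\Lambda(dz)z\int n_B(dy)\,(F(z+y)-F(z))^2.$$ In particular, $\mathbf U(F)\le 2\,\mathbf V(F)$ for every $F\in D$, i.e. $$\int\Lambda(dz)(F(z)-F(0))^2\le\int\Lambda(dz)z\int n_B(dy)(F(z+y)-F(z))^2+\int n_I(dy)(F(y)-F(0))^2.$$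
   Context: $\Lambda$ is the Lévy measure on $(0,\infty)$ determined by $\log(1+\lambda^\alpha)=\int\Lambda(dz)(1-e^{-\lambda z})$ for all $\lambda\ge0$. The measures $n_B$, $n_I$ on $(0,\infty)$ are $n_B(dy)=\frac{\alpha+1}{\Gamma(1-\alpha)}y^{-\alpha-2}dy$ and $n_I(dy)=\frac{\alpha}{\Gamma(1-\alpha)}y^{-\alpha-1}dy$. *)

theory Defs
  imports "HOL-Analysis.Analysis"
begin

text \<open>
  Measures on \<open>(0, \<infinity>)\<close> live on the measurable space \<^term>\<open>restrict_space borel {0::real<..}\<close>,
  so that every integral against them is an integral over \<open>(0, \<infinity>)\<close>.
\<close>

definition levy_measure :: "real measure \<Rightarrow> bool" where
  "levy_measure \<Lambda> \<longleftrightarrow>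
     sets \<Lambda> = sets (restrict_space borel {0<..}) \<and>
     (\<integral>\<^sup>+ z. ennreal (min 1 (z\<^sup>2)) \<partial>\<Lambda>) < \<infinity>"

text \<open>
  The measure determined by \<open>log (1 + r\<^sup>\<alpha>) = \<integral> \<Lambda>(dz) (1 - exp (- r z))\<close>; at \<open>r = 0\<close> the convention
  \<open>0 powr \<alpha> = 0\<close> is the intended one.
\<close>

definition log_exponent_measure :: "real \<Rightarrow> real measure \<Rightarrow> bool" where
  "log_exponent_measure \<alpha> \<Lambda> \<longleftrightarrow>
     levy_measure \<Lambda> \<and>
     (\<forall>r\<ge>0. has_bochner_integral \<Lambda> (\<lambda>z. 1 - exp (- r * z)) (ln (1 + r powr \<alpha>)))"

definition n_B :: "real \<Rightarrow> real measure" where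
  "n_B \<alpha> = density (restrict_space lborel {0<..})
     (\<lambda>y. ennreal ((\<alpha> + 1) / Gamma (1 - \<alpha>) * y powr (- \<alpha> - 2)))"

definition n_I :: "real \<Rightarrow> real measure" where
  "n_I \<alpha> = density (restrict_space lborel {0<..})
     (\<lambda>y. ennreal (\<alpha> / Gamma (1 - \<alpha>) * y powr (- \<alpha> - 1)))"

text \<open>
  The linear span of the functions \<open>z \<mapsto> exp (- r z)\<close>, \<open>r > 0\<close>, on \<open>[0, \<infinity>)\<close>. Functions on
  \<open>[0, \<infinity>)\<close> are represented by total functions whose values on the negative half-line are
  arbitrary.
\<close>

definition exp_span :: "(real \<Rightarrow> real) set" where
  "exp_span = {F. \<exists>L c. finite L \<and> L \<subseteq> {0<..} \<and>
                   (\<forall>z\<ge>0. F z = (\<Sum>r\<in>L. c r * exp (- r * z)))}"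

definition U_form :: "real measure \<Rightarrow> (real \<Rightarrow> real) \<Rightarrow> real" where
  "U_form \<Lambda> F = (\<integral>z. (F z - F 0)\<^sup>2 \<partial>\<Lambda>)"

definition V_form :: "real \<Rightarrow> real measure \<Rightarrow> (real \<Rightarrow> real) \<Rightarrow> real" where
  "V_form \<alpha> \<Lambda> F =
     1 / 2 * ((\<integral>z. z * (\<integral>y. (F (z + y) - F z)\<^sup>2 \<partial>n_B \<alpha>) \<partial>\<Lambda>) + (\<integral>y. (F y - F 0)\<^sup>2 \<partial>n_I \<alpha>))"

text \<open>
  The Bochner integral of a non-integrable function is \<open>0\<close>. For an iterated integral
  \<open>\<integral> M(dz) w(z) \<integral> N(dy) g(z, y)\<close> the following predicate says that all the integrals in it
  exist, so that it has its usual meaning.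
\<close>

definition iterated_integrable ::
  "real measure \<Rightarrow> real measure \<Rightarrow> (real \<Rightarrow> real) \<Rightarrow> (real \<Rightarrow> real \<Rightarrow> real) \<Rightarrow> bool" where
  "iterated_integrable M N w g \<longleftrightarrow>
     (\<forall>z\<in>space M. integrable N (g z)) \<and> integrable M (\<lambda>z. w z * (\<integral>y. g z y \<partial>N))"

end

theory Submission
  imports Defs
begin

text \<open>
  Put \<open>G = F - F(0)\<close>. Since \<open>n_B(dy) = (\<alpha> + 1) / \<alpha> \<cdot> n_I(dy) / y\<close>, a pointwise algebraic identity
  turns the claim into
  \<open>\<integral> n_I(dy) g(y) = \<integral> \<Lambda>(dz) g(z) + \<integral> \<Lambda>(dz) \<integral> n_I(dy) (g(z) - z / (z + y) \<cdot> g(z + y))\<close> for \<open>g = G\<^sup>2\<close>.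
  This is linear in \<open>g\<close>, and \<open>G\<^sup>2\<close> is a linear combination of functions \<open>g(z) = 1 - exp (- r z)\<close>.
  For these \<open>g(z) / z\<close> is the integral of \<open>exp (- t z)\<close> over \<open>t \<in> [0, r]\<close>, so Tonelli's theorem reduces
  the identity to \<open>\<integral> n_I(dy) (1 - exp (- t y)) = t\<^sup>\<alpha>\<close> and to
  \<open>\<integral> \<Lambda>(dz) z exp (- t z) = \<alpha> t powr (\<alpha> - 1) / (1 + t\<^sup>\<alpha>)\<close>, the derivative of the exponent of \<open>\<Lambda>\<close>.
\<close>

section \<open>Integrals of powers on the half-line and a criterion for sigma-finiteness\<close>

lemma nn_integral_powr_exp:
  fixes a t :: real
  assumes "a > 0" "t > 0"
  shows "(\<integral>\<^sup>+y. ennreal (y powr (a - 1) * exp (- t * y)) * indicator {0<..} y \<partial>lborel)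
           = ennreal (Gamma a * t powr (- a))"
proof -
  let ?f = "\<lambda>u. ennreal (indicator {0..} u * u powr (a - 1) / exp u)"
  let ?I = "\<integral>\<^sup>+y. ennreal (y powr (a - 1) * exp (- t * y)) * indicator {0<..} y \<partial>lborel"
  have "ennreal (Gamma a) = (\<integral>\<^sup>+u. ?f u \<partial>lborel)"
    using Gamma_conv_nn_integral_real[OF assms(1)] .
  also have "\<dots> = \<bar>t\<bar> * (\<integral>\<^sup>+y. ?f (0 + t * y) \<partial>lborel)"
    using assms by (intro nn_integral_real_affine) auto
  also have "(\<integral>\<^sup>+y. ?f (0 + t * y) \<partial>lborel) = (\<integral>\<^sup>+y. ennreal (t powr (a - 1)) *
      (ennreal (y powr (a - 1) * exp (- t * y)) * indicator {0<..} y) \<partial>lborel)"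
    using assms
    by (intro nn_integral_cong)
       (auto simp: indicator_def powr_mult exp_minus field_simps zero_le_mult_iff
             simp flip: ennreal_mult')
  also have "\<dots> = ennreal (t powr (a - 1)) * ?I"
    by (intro nn_integral_cmult) auto
  also have "\<bar>t\<bar> * (ennreal (t powr (a - 1)) * ?I) = ennreal (t powr a) * ?I"
    using assms by (simp add: mult.assoc[symmetric] ennreal_mult'[symmetric] powr_mult_base)
  \<comment> \<open>Multiplying by \<open>t powr (- a)\<close> replaces a division in
    \<open>ennreal\<close>, where \<open>?I\<close> is not yet known to be finite.\<close>
  finally have "ennreal (t powr (- a)) * ennreal (Gamma a) = ennreal (t powr (- a)) * ennreal (t powr a) * ?I"
    by (simp add: mult.assoc)
  then show ?thesis
    using assms by (simp add: ennreal_mult'[symmetric] powr_add[symmetric] mult.commute)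
qed

text \<open>Differentiability is asked only in the open interval because antiderivatives such as
  \<open>t powr \<alpha>\<close> with \<alpha> < 1 have no finite derivative at 0.\<close>

lemma nn_integral_deriv_interior:
  fixes f f' :: "real \<Rightarrow> real"
  assumes "a \<le> b" "continuous_on {a..b} f"
    and "\<And>x. x \<in> {a<..<b} \<Longrightarrow> (f has_real_derivative f' x) (at x)"
    and "\<And>x. x \<in> {a..b} \<Longrightarrow> 0 \<le> f' x"
  shows "(\<integral>\<^sup>+x. ennreal (f' x) * indicator {a..b} x \<partial>lborel) = ennreal (f b - f a)"
proof (rule nn_integral_has_integral_lebesgue')
  show "(f' has_integral (f b - f a)) {a..b}"
    using assms(1-3)
    by (intro fundamental_theorem_of_calculus_interior)
       (auto simp: has_real_derivative_iff_has_vector_derivative)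
qed (use assms(4) in auto)

lemma nn_integral_powr_Icc:
  fixes \<alpha> r :: real
  assumes "0 < \<alpha>" "0 \<le> r"
  shows "(\<integral>\<^sup>+t. ennreal (\<alpha> * t powr (\<alpha> - 1)) * indicator {0..r} t \<partial>lborel) = ennreal (r powr \<alpha>)"
proof -
  have "(\<integral>\<^sup>+t. ennreal (\<alpha> * t powr (\<alpha> - 1)) * indicator {0..r} t \<partial>lborel)
      = ennreal (r powr \<alpha> - 0 powr \<alpha>)"
    using assms
    by (intro nn_integral_deriv_interior continuous_on_powr')
       (auto intro!: derivative_eq_intros continuous_intros)
  then show ?thesis by simp
qed

text \<open>The antiderivative comes from writing x / (1 + x) as 1 - 1 / (1 + x) with x =
  \<open>t powr \<alpha>\<close>. In the integrand the first factor will be supplied by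
  \<open>n_I\<close> and the quotient by \<Lambda>, once Tonelli has moved the integral over t
  outside.\<close>

lemma nn_integral_powr_log_Icc:
  fixes \<alpha> r :: real
  assumes "0 < \<alpha>" "0 \<le> r"
  shows "(\<integral>\<^sup>+t. ennreal (t powr \<alpha> * (\<alpha> * t powr (\<alpha> - 1) / (1 + t powr \<alpha>))) * indicator {0..r} t \<partial>lborel)
    = ennreal (r powr \<alpha> - ln (1 + r powr \<alpha>))"
proof -
  let ?f = "\<lambda>t. t powr \<alpha> - ln (1 + t powr \<alpha>)"
  have pos: "1 + t powr \<alpha> > 0" for t :: real by (smt (verit) powr_ge_zero)
  have "(\<integral>\<^sup>+t. ennreal (t powr \<alpha> * (\<alpha> * t powr (\<alpha> - 1) / (1 + t powr \<alpha>))) * indicator {0..r} t \<partial>lborel)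
      = ennreal (?f r - ?f 0)"
  proof (rule nn_integral_deriv_interior)
    show "continuous_on {0..r} ?f"
      using assms pos by (intro continuous_intros continuous_on_powr') (auto simp: less_imp_neq[THEN not_sym])
    show "(?f has_real_derivative (x powr \<alpha> * (\<alpha> * x powr (\<alpha> - 1) / (1 + x powr \<alpha>)))) (at x)"
      if "x \<in> {0<..<r}" for x
      using that assms pos[of x]
      by (auto intro!: derivative_eq_intros simp: field_simps)
  qed (use assms pos in \<open>auto simp: less_imp_le\<close>)
  then show ?thesis using assms by simp
qed

text \<open>The measure with density f is finite, and M is recovered from it through the density 1 /
  f, whose values are finite. Applied to 1 - exp (- z), this supplies the sigma-finiteness that
  Tonelli's theorem asks of \<Lambda> and \<open>n_I\<close>.\<close>

lemma sigma_finite_measure_integrable_pos: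
  fixes f :: "'a \<Rightarrow> real"
  assumes f: "integrable M f" and pos: "\<And>x. x \<in> space M \<Longrightarrow> 0 < f x"
  shows "sigma_finite_measure M"
proof -
  have [measurable]: "f \<in> borel_measurable M" using f by auto
  let ?N = "density M f"
  have "emeasure ?N (space ?N) = (\<integral>\<^sup>+x. ennreal (f x) \<partial>M)"
    by (simp add: emeasure_density cong: nn_integral_cong)
  also have "\<dots> = ennreal (integral\<^sup>L M f)"
    using f pos by (intro nn_integral_eq_integral) (auto intro: less_imp_le AE_I2)
  finally interpret N: finite_measure ?N by (intro finite_measureI) auto
  have "M = density M (\<lambda>x. ennreal (f x) * ennreal (1 / f x))"
    by (subst density_cong[where f' = "\<lambda>_. 1"])
       (use pos in \<open>auto simp: ennreal_mult'[symmetric] less_imp_le density_1 less_imp_neq[THEN not_sym]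
          intro!: AE_I2 \<close>)
  also have "\<dots> = density ?N (\<lambda>x. ennreal (1 / f x))"
    by (subst density_density_eq) auto
  finally have M: "M = density ?N (\<lambda>x. ennreal (1 / f x))" .
  have "sigma_finite_measure (density ?N (\<lambda>x. ennreal (1 / f x)))"
    by (subst N.sigma_finite_iff_density_finite) auto
  with M show ?thesis by simp
qed

section \<open>The measures \<open>n_I\<close> and \<open>n_B\<close>, and the Laplace exponent of
  \<open>n_I\<close>\<close>

lemma space_n_I [simp]: "space (n_I \<alpha>) = {0<..}"
  by (simp add: n_I_def space_restrict_space)

lemma sets_n_I [measurable_cong, simp]: "sets (n_I \<alpha>) = sets (restrict_space borel {0<..})"
  by (simp add: n_I_def sets_restrict_space)

lemma space_n_B [simp]: "space (n_B \<alpha>) = {0<..}"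
  by (simp add: n_B_def space_restrict_space)

lemma borel_measurable_cong_restrict:
  assumes "sets M = sets (restrict_space borel A)" "f \<in> borel_measurable borel"
  shows "f \<in> borel_measurable M"
  using assms measurable_cong_sets measurable_restrict_space1 by metis

lemma nn_integral_n_I:
  assumes [measurable]: "f \<in> borel_measurable borel"
  shows "(\<integral>\<^sup>+y. f y \<partial>n_I \<alpha>) =
    (\<integral>\<^sup>+y. ennreal (\<alpha> / Gamma (1 - \<alpha>) * y powr (- \<alpha> - 1)) * f y * indicator {0<..} y \<partial>lborel)"
  unfolding n_I_def
  by (subst nn_integral_density)
     (auto simp: nn_integral_restrict_space intro!: measurable_restrict_space1)

lemma nn_integral_exp_Icc:
  fixes y s :: real
  assumes "0 < y" "0 \<le> s"
  shows "(\<integral>\<^sup>+t. ennreal (y * exp (- t * y)) * indicator {0..s} t \<partial>lborel) = ennreal (1 - exp (- s * y))"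
proof -
  have "(\<integral>\<^sup>+t. ennreal (y * exp (- t * y)) * indicator {0..s} t \<partial>lborel)
      = ennreal (- exp (- s * y) - (- exp (- 0 * y)))"
    using assms by (intro nn_integral_FTC_Icc) (auto intro!: derivative_eq_intros)
  then show ?thesis by simp
qed

text \<open>Write 1 - exp (- s y) as the integral of y exp (- t y) over t in [0, s] and swap the
  integrals. The integral over y is then a Gamma integral with parameter 1 - \<alpha>, whose value
  cancels the normalising constant of \<open>n_I\<close> and leaves the derivative of
  t^\<alpha>.\<close>

lemma has_bochner_integral_n_I_exp:
  assumes \<alpha>: "0 < \<alpha>" "\<alpha> < 1" and s: "0 \<le> s"
  shows "has_bochner_integral (n_I \<alpha>) (\<lambda>y. 1 - exp (- s * y)) (s powr \<alpha>)"
proof (rule has_bochner_integral_nn_integral)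
  define c where "c = \<alpha> / Gamma (1 - \<alpha>)"
  have c: "c > 0" using \<alpha> by (simp add: c_def Gamma_real_pos)
  have "(\<integral>\<^sup>+y. ennreal (1 - exp (- s * y)) \<partial>n_I \<alpha>) =
    (\<integral>\<^sup>+y. ennreal (c * y powr (- \<alpha> - 1)) * ennreal (1 - exp (- s * y)) * indicator {0<..} y \<partial>lborel)"
    by (subst nn_integral_n_I) (auto simp: c_def)
  also have "\<dots> = (\<integral>\<^sup>+y. (\<integral>\<^sup>+t. ennreal (c * (y powr - \<alpha> * exp (- t * y))) * indicator {0..s} t * indicator {0<..} y \<partial>lborel) \<partial>lborel)"
  proof (rule nn_integral_cong)
    fix y :: real
    show "ennreal (c * y powr (- \<alpha> - 1)) * ennreal (1 - exp (- s * y)) * indicator {0<..} y =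
      (\<integral>\<^sup>+t. ennreal (c * (y powr - \<alpha> * exp (- t * y))) * indicator {0..s} t * indicator {0<..} y \<partial>lborel)"
    proof (cases "y > 0")
      case True
      have "ennreal (c * y powr (- \<alpha> - 1)) * ennreal (1 - exp (- s * y)) =
          ennreal (c * y powr (- \<alpha> - 1)) * (\<integral>\<^sup>+t. ennreal (y * exp (- t * y)) * indicator {0..s} t \<partial>lborel)"
        using True s by (subst nn_integral_exp_Icc) auto
      also have "\<dots> = (\<integral>\<^sup>+t. ennreal (c * y powr (- \<alpha> - 1)) * (ennreal (y * exp (- t * y)) * indicator {0..s} t) \<partial>lborel)"
        by (subst nn_integral_cmult) auto
      also have "\<dots> = (\<integral>\<^sup>+t. ennreal (c * (y powr - \<alpha> * exp (- t * y))) * indicator {0..s} t \<partial>lborel)"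
        using True c by (intro nn_integral_cong)
          (auto simp: ennreal_mult'[symmetric] indicator_def powr_diff)
      finally show ?thesis using True by simp
    qed auto
  qed
  also have "\<dots> = (\<integral>\<^sup>+t. (\<integral>\<^sup>+y. ennreal (c * (y powr - \<alpha> * exp (- t * y))) * indicator {0..s} t * indicator {0<..} y \<partial>lborel) \<partial>lborel)"
    by (intro lborel_pair.Fubini') auto
  also have "\<dots> = (\<integral>\<^sup>+t. ennreal (\<alpha> * t powr (\<alpha> - 1)) * indicator {0..s} t \<partial>lborel)"
  proof (rule nn_integral_cong_AE)
    \<comment> \<open>At t = 0 the integral over y diverges while the right-hand side is 0 by the
      convention for \<open>powr\<close>, so this point is discarded as a null set.\<close>
    have "AE t in lborel. t \<noteq> (0::real)" by (rule AE_lborel_singleton)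
    then show "AE t in lborel. (\<integral>\<^sup>+y. ennreal (c * (y powr - \<alpha> * exp (- t * y))) * indicator {0..s} t * indicator {0<..} y \<partial>lborel)
        = ennreal (\<alpha> * t powr (\<alpha> - 1)) * indicator {0..s} t"
    proof eventually_elim
      case (elim t)
      show ?case
      proof (cases "t \<in> {0..s}")
        case True
        have "(\<integral>\<^sup>+y. ennreal (c * (y powr - \<alpha> * exp (- t * y))) * indicator {0..s} t * indicator {0<..} y \<partial>lborel)
          = (\<integral>\<^sup>+y. ennreal c * (ennreal (y powr ((1 - \<alpha>) - 1) * exp (- t * y)) * indicator {0<..} y) \<partial>lborel)"
          using True c by (intro nn_integral_cong) (auto simp: ennreal_mult' mult.assoc)
        also have "\<dots> = ennreal c * ennreal (Gamma (1 - \<alpha>) * t powr (- (1 - \<alpha>)))"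
          using True elim \<alpha>
          by (subst nn_integral_cmult, measurable, subst nn_integral_powr_exp) auto
        also have "\<dots> = ennreal (\<alpha> * t powr (\<alpha> - 1))"
          using c \<alpha> by (auto simp: ennreal_mult'[symmetric] c_def Gamma_eq_zero_iff nonpos_Ints_def)
        finally show ?thesis using True by simp
      qed auto
    qed
  qed
  also have "\<dots> = ennreal (s powr \<alpha>)"
    using \<alpha> s by (intro nn_integral_powr_Icc)
  finally show "(\<integral>\<^sup>+y. ennreal (1 - exp (- s * y)) \<partial>n_I \<alpha>) = ennreal (s powr \<alpha>)" .
qed (use s in \<open>auto intro!: AE_I2 borel_measurable_cong_restrict[OF sets_n_I]\<close>)

section \<open>The measure \<Lambda> and the derivative of its exponent\<close>

lemma
  assumes "log_exponent_measure \<alpha> \<Lambda>"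
  shows sets_log_exponent_measure: "sets \<Lambda> = sets (restrict_space borel {0<..})"
    and space_log_exponent_measure: "space \<Lambda> = {0<..}"
    and has_bochner_integral_one_minus_exp:
      "0 \<le> r \<Longrightarrow> has_bochner_integral \<Lambda> (\<lambda>z. 1 - exp (- r * z)) (ln (1 + r powr \<alpha>))"
proof -
  show *: "sets \<Lambda> = sets (restrict_space borel {0<..})"
    using assms by (simp add: log_exponent_measure_def levy_measure_def)
  show "space \<Lambda> = {0<..}"
    using sets_eq_imp_space_eq[OF *] by (simp add: space_restrict_space)
  show "0 \<le> r \<Longrightarrow> has_bochner_integral \<Lambda> (\<lambda>z. 1 - exp (- r * z)) (ln (1 + r powr \<alpha>))"
    using assms by (simp add: log_exponent_measure_def)
qed

text \<open>Differentiation of the exponent under the integral sign at s, by dominated convergence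
  of the difference quotients with increments 1 / (n + 1). Integrability of the limit is obtained at
  the same time.\<close>

lemma has_bochner_integral_mult_exp:
  assumes \<Lambda>: "log_exponent_measure \<alpha> \<Lambda>" and s: "0 < s"
  shows "has_bochner_integral \<Lambda> (\<lambda>z. z * exp (- s * z)) (\<alpha> * s powr (\<alpha> - 1) / (1 + s powr \<alpha>))"
proof -
  let ?h = "\<lambda>n. inverse (real (Suc n))"
  let ?d = "\<lambda>n z. ((1 - exp (- (s + ?h n) * z)) - (1 - exp (- s * z))) / ?h n"
  let ?l = "\<lambda>s. ln (1 + s powr \<alpha>)"
  have h0: "filterlim ?h (at 0) sequentially"
    using LIMSEQ_inverse_real_of_nat by (simp add: filterlim_at)
  have meas: "f \<in> borel_measurable \<Lambda>" if "f \<in> borel_measurable borel" for f :: "real \<Rightarrow> real"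
    using sets_log_exponent_measure[OF \<Lambda>] that by (rule borel_measurable_cong_restrict)
  have d: "has_bochner_integral \<Lambda> (?d n) ((?l (s + ?h n) - ?l s) / ?h n)" for n
    using s by (intro has_bochner_integral_divide has_bochner_integral_diff
      has_bochner_integral_one_minus_exp[OF \<Lambda>]) (auto intro: add_nonneg_nonneg)
  have dom: "integrable \<Lambda> (\<lambda>z. 1 / s * (1 - exp (- s * z)))"
    using has_bochner_integral_one_minus_exp[OF \<Lambda>, of s] s
    by (intro integrable_mult_right) (auto simp: has_bochner_integral_iff)
  have lim: "(\<lambda>n. ?d n z) \<longlonglongrightarrow> z * exp (- s * z)" for z
  proof -
    have "((\<lambda>s. 1 - exp (- s * z)) has_real_derivative z * exp (- s * z)) (at s)"
      by (auto intro!: derivative_eq_intros)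
    then show ?thesis
      unfolding has_field_derivative_def[symmetric] DERIV_def
      using filterlim_compose[OF _ h0] by fastforce
  qed
  \<comment> \<open>Factoring out exp (- s z) and using 1 - exp (- x) \<le> x bounds the quotient by
    z exp (- s z). The inequality 1 + s z \<le> exp (s z) then bounds this by a multiple of 1 - exp
    (- s z), which is integrable by the hypothesis on \<Lambda>.\<close>
  have bound: "norm (?d n z) \<le> 1 / s * (1 - exp (- s * z))" if "z > 0" for n z
  proof -
    have h: "?h n > 0" by simp
    have "1 - exp (- ?h n * z) \<le> ?h n * z"
      using exp_ge_add_one_self[of "- ?h n * z"] by simp
    then have "exp (- s * z) * (1 - exp (- ?h n * z)) / ?h n \<le> exp (- s * z) * (?h n * z) / ?h n"
      using h by (intro divide_right_mono mult_left_mono) auto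
    moreover have "exp (- (s + ?h n) * z) = exp (- s * z) * exp (- ?h n * z)"
      by (simp add: exp_add[symmetric] ring_distribs del: inverse_eq_divide of_nat_Suc)
    ultimately have "?d n z \<le> z * exp (- s * z)"
      using h by (simp add: right_diff_distrib mult.commute del: inverse_eq_divide of_nat_Suc)
    also have "\<dots> \<le> 1 / s * (1 - exp (- s * z))"
    proof -
      have "exp (- s * z) * (1 + s * z) \<le> exp (- s * z) * exp (s * z)"
        by (intro mult_left_mono exp_ge_add_one_self) auto
      then show ?thesis using s by (simp add: field_simps exp_minus)
    qed
    finally have 1: "?d n z \<le> 1 / s * (1 - exp (- s * z))" .
    have "exp (- (s + ?h n) * z) \<le> exp (- s * z)"
      using that by (auto simp: algebra_simps)
    then have "?d n z \<ge> 0" using h by (intro divide_nonneg_nonneg) auto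
    with 1 show ?thesis by simp
  qed
  have AE: "AE z in \<Lambda>. (\<lambda>n. ?d n z) \<longlonglongrightarrow> z * exp (- s * z)"
      "AE z in \<Lambda>. norm (?d n z) \<le> 1 / s * (1 - exp (- s * z))" for n
  proof -
    show "AE z in \<Lambda>. (\<lambda>n. ?d n z) \<longlonglongrightarrow> z * exp (- s * z)"
      by (rule AE_I2) (rule lim)
    show "AE z in \<Lambda>. norm (?d n z) \<le> 1 / s * (1 - exp (- s * z))"
    proof (rule AE_I2)
      fix z assume "z \<in> space \<Lambda>"
      then show "norm (?d n z) \<le> 1 / s * (1 - exp (- s * z))"
        by (intro bound) (simp add: space_log_exponent_measure[OF \<Lambda>])
    qed
  qed
  have md: "(\<lambda>z. z * exp (- s * z)) \<in> borel_measurable \<Lambda>" "?d n \<in> borel_measurable \<Lambda>" for n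
    by (intro meas; measurable)+
  note conv = integrable_dominated_convergence[OF md dom AE] integral_dominated_convergence[OF md dom AE]
  \<comment> \<open>The integrals of the quotients are difference quotients of \<open>?l\<close>, so
    they also converge to its derivative; uniqueness of limits identifies the integral of the limit
    function.\<close>
  have "(?l has_real_derivative \<alpha> * s powr (\<alpha> - 1) / (1 + s powr \<alpha>)) (at s)"
    using s by (auto intro!: derivative_eq_intros simp: add_pos_nonneg)
  then have "(\<lambda>n. (?l (s + ?h n) - ?l s) / ?h n) \<longlonglongrightarrow> \<alpha> * s powr (\<alpha> - 1) / (1 + s powr \<alpha>)"
    unfolding DERIV_def using filterlim_compose[OF _ h0] by fastforce
  then have "(\<lambda>n. integral\<^sup>L \<Lambda> (?d n)) \<longlonglongrightarrow> \<alpha> * s powr (\<alpha> - 1) / (1 + s powr \<alpha>)"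
    using d by (simp add: has_bochner_integral_iff)
  with conv show ?thesis
    using LIMSEQ_unique by (auto simp: has_bochner_integral_iff)
qed

lemma sigma_finite_log_exponent_measure:
  assumes "log_exponent_measure \<alpha> \<Lambda>"
  shows "sigma_finite_measure \<Lambda>"
  using has_bochner_integral_one_minus_exp[OF assms, of 1]
  by (intro sigma_finite_measure_integrable_pos[where f = "\<lambda>z. 1 - exp (- 1 * z)"])
     (auto simp: has_bochner_integral_iff space_log_exponent_measure[OF assms])

lemma sigma_finite_n_I:
  assumes "0 < \<alpha>" "\<alpha> < 1"
  shows "sigma_finite_measure (n_I \<alpha>)"
  using has_bochner_integral_n_I_exp[OF assms, of 1]
  by (intro sigma_finite_measure_integrable_pos[where f = "\<lambda>z. 1 - exp (- 1 * z)"])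
     (auto simp: has_bochner_integral_iff)

section \<open>The defect, z times the drop of g(z) / z between z and z + y\<close>

definition defect :: "(real \<Rightarrow> real) \<Rightarrow> real \<Rightarrow> real \<Rightarrow> real" where
  "defect g z y = g z - z / (z + y) * g (z + y)"

text \<open>For this g the quotient g(z) / z is the integral of exp (- t z) over [0, r], so its drop
  is the integral of exp (- t z) - exp (- t (z + y)), which is nonnegative. This gives both claims;
  \<open>?f\<close> is the corresponding antiderivative in t, scaled by z.\<close>

lemma
  assumes "0 \<le> r" "0 < z" "0 < y"
  shows nn_integral_defect_exp:
      "(\<integral>\<^sup>+t. ennreal (z * exp (- t * z) * (1 - exp (- t * y))) * indicator {0..r} t \<partial>lborel)
        = ennreal (defect (\<lambda>z. 1 - exp (- r * z)) z y)"
    and defect_exp_nonneg: "0 \<le> defect (\<lambda>z. 1 - exp (- r * z)) z y"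
proof -
  let ?f = "\<lambda>t. - exp (- t * z) + z / (z + y) * exp (- t * (z + y))"
  let ?f' = "\<lambda>t. z * exp (- t * z) * (1 - exp (- t * y))"
  have f: "?f r - ?f 0 = defect (\<lambda>z. 1 - exp (- r * z)) z y"
    by (simp add: defect_def algebra_simps)
  have deriv: "(?f has_real_derivative ?f' t) (at t)" for t
  proof -
    have "((\<lambda>t. - exp (- t * z) + c * exp (- t * w)) has_real_derivative
        z * exp (- t * z) - (c * w) * exp (- t * w)) (at t)" for c w
      by (auto intro!: derivative_eq_intros)
    then have "(?f has_real_derivative z * exp (- t * z) - (z / (z + y) * (z + y)) * exp (- t * (z + y))) (at t)" .
    also have "z / (z + y) * (z + y) = z" using assms by simp
    also have "z * exp (- t * z) - z * exp (- t * (z + y)) = ?f' t"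
      by (simp add: algebra_simps exp_add[symmetric])
    finally show ?thesis .
  qed
  have nonneg: "0 \<le> ?f' t" if "0 \<le> t" for t using that assms by auto
  show "(\<integral>\<^sup>+t. ennreal (?f' t) * indicator {0..r} t \<partial>lborel)
      = ennreal (defect (\<lambda>z. 1 - exp (- r * z)) z y)"
    using assms nonneg unfolding f[symmetric]
    by (intro nn_integral_FTC_Icc deriv) auto
  have "?f 0 \<le> ?f r"
    using assms deriv nonneg by (intro DERIV_nonneg_imp_nondecreasing[of 0 r ?f]) blast+
  then show "0 \<le> defect (\<lambda>z. 1 - exp (- r * z)) z y"
    unfolding f[symmetric] by simp
qed

lemma measurable_defect:
  assumes [measurable]: "g \<in> borel_measurable borel"
    and M: "sets M = sets (restrict_space borel A)" and N: "sets N = sets (restrict_space borel B)"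
  shows "(\<lambda>(z, y). defect g z y) \<in> borel_measurable (M \<Otimes>\<^sub>M N)" "defect g z \<in> borel_measurable N"
proof -
  have [measurable]: "(\<lambda>x. x) \<in> borel_measurable M" "(\<lambda>x. x) \<in> borel_measurable N"
    using M N by (auto intro: borel_measurable_cong_restrict)
  have [measurable]: "fst \<in> borel_measurable (M \<Otimes>\<^sub>M N)" "snd \<in> borel_measurable (M \<Otimes>\<^sub>M N)"
    using measurable_compose[OF measurable_fst, of "\<lambda>x. x" M borel]
      measurable_compose[OF measurable_snd, of "\<lambda>x. x" N borel] by auto
  show "(\<lambda>(z, y). defect g z y) \<in> borel_measurable (M \<Otimes>\<^sub>M N)" "defect g z \<in> borel_measurable N"
    unfolding defect_def by measurable
qed

section \<open>The linear identity between \<open>n_I\<close>, \<Lambda> and the averaged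
  defect\<close>

context
  fixes \<alpha> :: real and \<Lambda> :: "real measure"
  assumes \<alpha>: "0 < \<alpha>" "\<alpha> < 1" and \<Lambda>: "log_exponent_measure \<alpha> \<Lambda>"
begin

interpretation L: sigma_finite_measure \<Lambda>
  using \<Lambda> by (rule sigma_finite_log_exponent_measure)
interpretation N: sigma_finite_measure "n_I \<alpha>"
  using \<alpha> by (rule sigma_finite_n_I)
interpretation NB: pair_sigma_finite "n_I \<alpha>" lborel ..
interpretation LB: pair_sigma_finite \<Lambda> lborel ..

text \<open>First use of Tonelli: for fixed t, integrating 1 - exp (- t y) over y against
  \<open>n_I\<close> gives the stable exponent \<open>t powr \<alpha>\<close>.\<close>

lemma nn_integral_n_I_defect_exp:
  assumes "0 \<le> r" "0 < z"
  shows "(\<integral>\<^sup>+y. ennreal (defect (\<lambda>z. 1 - exp (- r * z)) z y) \<partial>n_I \<alpha>) =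
    (\<integral>\<^sup>+t. ennreal (z * exp (- t * z) * t powr \<alpha>) * indicator {0..r} t \<partial>lborel)"
proof -
  have [measurable]: "(\<lambda>x. x) \<in> borel_measurable (n_I \<alpha>)"
    by (auto intro: borel_measurable_cong_restrict)
  have "(\<integral>\<^sup>+y. ennreal (defect (\<lambda>z. 1 - exp (- r * z)) z y) \<partial>n_I \<alpha>) =
    (\<integral>\<^sup>+y. (\<integral>\<^sup>+t. ennreal (z * exp (- t * z) * (1 - exp (- t * y))) * indicator {0..r} t \<partial>lborel) \<partial>n_I \<alpha>)"
    using assms by (intro nn_integral_cong nn_integral_defect_exp[symmetric]) auto
  also have "\<dots> = (\<integral>\<^sup>+t. (\<integral>\<^sup>+y. ennreal (z * exp (- t * z) * (1 - exp (- t * y))) * indicator {0..r} t \<partial>n_I \<alpha>) \<partial>lborel)"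
    by (intro NB.Fubini'[symmetric]) measurable
  also have "\<dots> = (\<integral>\<^sup>+t. ennreal (z * exp (- t * z) * t powr \<alpha>) * indicator {0..r} t \<partial>lborel)"
  proof (intro nn_integral_cong)
    fix t :: real
    show "(\<integral>\<^sup>+y. ennreal (z * exp (- t * z) * (1 - exp (- t * y))) * indicator {0..r} t \<partial>n_I \<alpha>)
      = ennreal (z * exp (- t * z) * t powr \<alpha>) * indicator {0..r} t"
    proof (cases "t \<in> {0..r}")
      case True
      have "has_bochner_integral (n_I \<alpha>) (\<lambda>y. z * exp (- t * z) * (1 - exp (- t * y))) (z * exp (- t * z) * t powr \<alpha>)"
        using True by (intro has_bochner_integral_mult_right has_bochner_integral_n_I_exp \<alpha>) auto
      then have "(\<integral>\<^sup>+y. ennreal (z * exp (- t * z) * (1 - exp (- t * y))) \<partial>n_I \<alpha>) = ennreal (z * exp (- t * z) * t powr \<alpha>)"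
        using True assms by (subst nn_integral_eq_integral) (auto simp: has_bochner_integral_iff intro!: AE_I2)
      then show ?thesis using True by simp
    qed auto
  qed
  finally show ?thesis .
qed

text \<open>Second use of Tonelli: for fixed t, integrating z exp (- t z) against \<Lambda> gives
  the derivative of the exponent of \<Lambda>, and the remaining integral over t is
  elementary.\<close>

lemma nn_integral_iterated_defect_exp:
  assumes "0 \<le> r"
  shows "(\<integral>\<^sup>+z. (\<integral>\<^sup>+y. ennreal (defect (\<lambda>z. 1 - exp (- r * z)) z y) \<partial>n_I \<alpha>) \<partial>\<Lambda>) =
    ennreal (r powr \<alpha> - ln (1 + r powr \<alpha>))"
proof -
  have [measurable]: "(\<lambda>x. x) \<in> borel_measurable \<Lambda>"
    using sets_log_exponent_measure[OF \<Lambda>] by (auto intro: borel_measurable_cong_restrict)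
  have "(\<integral>\<^sup>+z. (\<integral>\<^sup>+y. ennreal (defect (\<lambda>z. 1 - exp (- r * z)) z y) \<partial>n_I \<alpha>) \<partial>\<Lambda>) =
    (\<integral>\<^sup>+z. (\<integral>\<^sup>+t. ennreal (z * exp (- t * z) * t powr \<alpha>) * indicator {0..r} t \<partial>lborel) \<partial>\<Lambda>)"
    using assms by (intro nn_integral_cong nn_integral_n_I_defect_exp)
      (auto simp: space_log_exponent_measure[OF \<Lambda>])
  also have "\<dots> = (\<integral>\<^sup>+t. (\<integral>\<^sup>+z. ennreal (z * exp (- t * z) * t powr \<alpha>) * indicator {0..r} t \<partial>\<Lambda>) \<partial>lborel)"
    by (intro LB.Fubini'[symmetric]) measurable
  also have "\<dots> = (\<integral>\<^sup>+t. ennreal (t powr \<alpha> * (\<alpha> * t powr (\<alpha> - 1) / (1 + t powr \<alpha>))) * indicator {0..r} t \<partial>lborel)"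
  proof (intro nn_integral_cong)
    fix t :: real
    show "(\<integral>\<^sup>+z. ennreal (z * exp (- t * z) * t powr \<alpha>) * indicator {0..r} t \<partial>\<Lambda>)
      = ennreal (t powr \<alpha> * (\<alpha> * t powr (\<alpha> - 1) / (1 + t powr \<alpha>))) * indicator {0..r} t"
    \<comment> \<open>The derivative formula needs t > 0; at t = 0 both sides vanish because
      \<open>0 powr \<alpha>\<close> is 0.\<close>
    proof (cases "t \<in> {0<..r}")
      case True
      have "has_bochner_integral \<Lambda> (\<lambda>z. t powr \<alpha> * (z * exp (- t * z)))
          (t powr \<alpha> * (\<alpha> * t powr (\<alpha> - 1) / (1 + t powr \<alpha>)))"
        using True by (intro has_bochner_integral_mult_right has_bochner_integral_mult_exp \<Lambda>) auto
      then have "(\<integral>\<^sup>+z. ennreal (t powr \<alpha> * (z * exp (- t * z))) \<partial>\<Lambda>)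
          = ennreal (t powr \<alpha> * (\<alpha> * t powr (\<alpha> - 1) / (1 + t powr \<alpha>)))"
        by (subst nn_integral_eq_integral)
           (auto simp: has_bochner_integral_iff space_log_exponent_measure[OF \<Lambda>] intro!: AE_I2)
      then show ?thesis using True by (simp add: mult_ac)
    qed (auto simp: indicator_def)
  qed
  also have "\<dots> = ennreal (r powr \<alpha> - ln (1 + r powr \<alpha>))"
    using \<alpha> assms by (intro nn_integral_powr_log_Icc)
  finally show ?thesis .
qed

text \<open>The integrability clauses accompany the identity because Bochner integrals add up only
  for integrable functions; with them the property passes to linear combinations.\<close>

definition balanced :: "(real \<Rightarrow> real) \<Rightarrow> bool" where
  "balanced g \<longleftrightarrow> integrable \<Lambda> g \<and> integrable (n_I \<alpha>) g \<and>
     (\<forall>z>0. integrable (n_I \<alpha>) (defect g z)) \<and>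
     integrable \<Lambda> (\<lambda>z. \<integral>y. defect g z y \<partial>n_I \<alpha>) \<and>
     (\<integral>y. g y \<partial>n_I \<alpha>) = (\<integral>z. g z \<partial>\<Lambda>) + (\<integral>z. (\<integral>y. defect g z y \<partial>n_I \<alpha>) \<partial>\<Lambda>)"

text \<open>The three integrals in the identity are r^\<alpha>, log (1 + r^\<alpha>) and their
  difference, so it holds by inspection. What takes work is passing from nonnegative integrals to
  Bochner integrals.\<close>

lemma balanced_one_minus_exp:
  assumes r: "0 \<le> r"
  shows "balanced (\<lambda>z. 1 - exp (- r * z))"
proof -
  let ?g = "\<lambda>z. 1 - exp (- r * z)"
  note sL = sets_log_exponent_measure[OF \<Lambda>] and [simp] = space_log_exponent_measure[OF \<Lambda>]
  note [measurable] = measurable_defect[OF _ sL sets_n_I]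
  note nonneg = defect_exp_nonneg[OF r]
  have nnL: "ln (1 + r powr \<alpha>) \<le> r powr \<alpha>"
    by (rule ln_add_one_self_le_self) auto
  have int: "integrable (n_I \<alpha>) (defect ?g z)" if z: "0 < z" for z
  proof (rule integrableI_nonneg)
    show "defect ?g z \<in> borel_measurable (n_I \<alpha>)" by measurable
    \<comment> \<open>After the swap only the compact range [0, r] of t is left, where the integrand
      is at most z r^\<alpha>.\<close>
    have "(\<integral>\<^sup>+y. ennreal (defect ?g z y) \<partial>n_I \<alpha>) \<le>
       (\<integral>\<^sup>+t. ennreal (z * r powr \<alpha>) * indicator {0..r} t \<partial>lborel)"
      unfolding nn_integral_n_I_defect_exp[OF r z]
    proof (intro nn_integral_mono)
      fix t :: real
      show "ennreal (z * exp (- t * z) * t powr \<alpha>) * indicator {0..r} t \<le> ennreal (z * r powr \<alpha>) * indicator {0..r} t"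
      proof (cases "t \<in> {0..r}")
        case True
        then have "exp (- t * z) * t powr \<alpha> \<le> 1 * r powr \<alpha>"
          using z \<alpha> by (intro mult_mono powr_mono2) auto
        then show ?thesis using z by (auto simp: indicator_def mult.assoc intro!: ennreal_leI)
      qed auto
    qed
    also have "\<dots> < \<infinity>"
      using r by (subst nn_integral_cmult_indicator) (auto simp: ennreal_mult_less_top)
    finally show "(\<integral>\<^sup>+y. ennreal (defect ?g z y) \<partial>n_I \<alpha>) < \<infinity>" .
  qed (use z nonneg in \<open>auto intro!: AE_I2\<close>)
  have "(\<integral>\<^sup>+z. ennreal (\<integral>y. defect ?g z y \<partial>n_I \<alpha>) \<partial>\<Lambda>) =
    (\<integral>\<^sup>+z. (\<integral>\<^sup>+y. ennreal (defect ?g z y) \<partial>n_I \<alpha>) \<partial>\<Lambda>)"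
    by (intro nn_integral_cong nn_integral_eq_integral[symmetric] int)
       (use nonneg in \<open>auto intro!: AE_I2\<close>)
  also note nn_integral_iterated_defect_exp[OF r]
  finally have "has_bochner_integral \<Lambda> (\<lambda>z. \<integral>y. defect ?g z y \<partial>n_I \<alpha>) (r powr \<alpha> - ln (1 + r powr \<alpha>))"
    using nonneg nnL
    by (intro has_bochner_integral_nn_integral) (auto intro!: AE_I2 integral_nonneg_AE)
  then show ?thesis
    using int has_bochner_integral_n_I_exp[OF \<alpha> r] has_bochner_integral_one_minus_exp[OF \<Lambda> r]
    unfolding balanced_def has_bochner_integral_iff by auto
qed

lemma balanced_add:
  assumes "balanced f" "balanced g"
  shows "balanced (\<lambda>z. f z + g z)"
proof -
  have *: "defect (\<lambda>z. f z + g z) z = (\<lambda>y. defect f z y + defect g z y)" for z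
    by (simp add: defect_def fun_eq_iff algebra_simps)
  have **: "(\<integral>y. defect f z y + defect g z y \<partial>n_I \<alpha>) = (\<integral>y. defect f z y \<partial>n_I \<alpha>) + (\<integral>y. defect g z y \<partial>n_I \<alpha>)"
    if "z > 0" for z
    using assms that by (intro Bochner_Integration.integral_add) (auto simp: balanced_def)
  \<comment> \<open>The inner integral is additive for z > 0, which is all of the space of
    \<Lambda>.\<close>
  have "has_bochner_integral \<Lambda> (\<lambda>z. \<integral>y. defect (\<lambda>z. f z + g z) z y \<partial>n_I \<alpha>)
     ((\<integral>z. (\<integral>y. defect f z y \<partial>n_I \<alpha>) \<partial>\<Lambda>) + (\<integral>z. (\<integral>y. defect g z y \<partial>n_I \<alpha>) \<partial>\<Lambda>))"
    using assms unfolding *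
    by (subst has_bochner_integral_cong[OF refl ** refl])
       (auto simp: space_log_exponent_measure[OF \<Lambda>] balanced_def has_bochner_integral_iff)
  then show ?thesis
    using assms unfolding * by (auto simp: balanced_def * has_bochner_integral_iff)
qed

lemma balanced_cmult:
  assumes "balanced f"
  shows "balanced (\<lambda>z. c * f z)"
proof -
  have *: "defect (\<lambda>z. c * f z) z = (\<lambda>y. c * defect f z y)" for z
    by (simp add: defect_def fun_eq_iff algebra_simps)
  show ?thesis
    using assms by (auto simp: balanced_def * ring_distribs)
qed

lemma balanced_sum:
  assumes "\<And>i. i \<in> I \<Longrightarrow> balanced (f i)"
  shows "balanced (\<lambda>z. \<Sum>i\<in>I. f i z)"
  using assms
proof (induction I rule: infinite_finite_induct)
  case (insert i I)
  then show ?case using balanced_add[of "f i"] by auto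
\<comment> \<open>Over an infinite index set the sum is 0 by convention, as over the empty one, and
  the zero function is balanced.\<close>
qed (auto simp: balanced_def defect_def[abs_def])

section \<open>From \<open>n_B\<close> to \<open>n_I\<close>, and the quadratic identity\<close>

lemma
  assumes f: "f \<in> borel_measurable (restrict_space borel {0<..})"
  shows integrable_n_B_iff: "integrable (n_B \<alpha>) f \<longleftrightarrow> integrable (n_I \<alpha>) (\<lambda>y. f y / y)"
    and integral_n_B: "(\<integral>y. f y \<partial>n_B \<alpha>) = (\<alpha> + 1) / \<alpha> * (\<integral>y. f y / y \<partial>n_I \<alpha>)"
proof -
  let ?M = "restrict_space lborel {0::real<..}"
  have sM [measurable_cong]: "sets ?M = sets (restrict_space borel {0<..})"
    by (simp add: sets_restrict_space)
  note [measurable] = f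
  have [measurable]: "(\<lambda>y. y) \<in> borel_measurable ?M"
    using sM by (rule borel_measurable_cong_restrict) auto
  have G: "Gamma (1 - \<alpha>) > 0" using \<alpha> by (simp add: Gamma_real_pos)
  \<comment> \<open>The density of \<open>n_B\<close> is (\<alpha> + 1) / \<alpha> times that of
    \<open>n_I\<close>, divided by y; everything below rests on this ratio.\<close>
  have eq: "(\<alpha> + 1) / Gamma (1 - \<alpha>) * y powr (- \<alpha> - 2) * f y =
      (\<alpha> + 1) / \<alpha> * (\<alpha> / Gamma (1 - \<alpha>) * y powr (- \<alpha> - 1) * (f y / y))" if "y \<in> space ?M" for y
  proof -
    have "y > 0" using that by (simp add: space_restrict_space)
    have "y powr (- \<alpha> - 2) = y powr ((- \<alpha> - 1) - 1)"
      by (rule arg_cong[where f = "(powr) y"]) simp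
    also have "\<dots> = y powr (- \<alpha> - 1) / y"
      using \<open>y > 0\<close> by (subst powr_diff) simp
    finally show ?thesis using \<alpha> by simp
  qed
  have "integrable (n_B \<alpha>) f \<longleftrightarrow> integrable ?M (\<lambda>y. (\<alpha> + 1) / Gamma (1 - \<alpha>) * y powr (- \<alpha> - 2) * f y)"
    unfolding n_B_def using \<alpha> G by (subst integrable_density) auto
  also have "\<dots> \<longleftrightarrow> integrable ?M (\<lambda>y. (\<alpha> + 1) / \<alpha> * (\<alpha> / Gamma (1 - \<alpha>) * y powr (- \<alpha> - 1) * (f y / y)))"
    by (rule Bochner_Integration.integrable_cong[OF refl eq])
  also have "\<dots> \<longleftrightarrow> integrable ?M (\<lambda>y. \<alpha> / Gamma (1 - \<alpha>) * y powr (- \<alpha> - 1) * (f y / y))"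
    using \<alpha> by (subst integrable_mult_left_iff) auto
  also have "\<dots> \<longleftrightarrow> integrable (n_I \<alpha>) (\<lambda>y. f y / y)"
    unfolding n_I_def using \<alpha> G by (subst integrable_density) auto
  finally show "integrable (n_B \<alpha>) f \<longleftrightarrow> integrable (n_I \<alpha>) (\<lambda>y. f y / y)" .
  have "(\<integral>y. f y \<partial>n_B \<alpha>) = (\<integral>y. (\<alpha> + 1) / Gamma (1 - \<alpha>) * y powr (- \<alpha> - 2) * f y \<partial>?M)"
    unfolding n_B_def using \<alpha> G by (subst integral_density) auto
  also have "\<dots> = (\<integral>y. (\<alpha> + 1) / \<alpha> * (\<alpha> / Gamma (1 - \<alpha>) * y powr (- \<alpha> - 1) * (f y / y)) \<partial>?M)"
    by (rule Bochner_Integration.integral_cong[OF refl eq])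
  also have "\<dots> = (\<alpha> + 1) / \<alpha> * (\<integral>y. \<alpha> / Gamma (1 - \<alpha>) * y powr (- \<alpha> - 1) * (f y / y) \<partial>?M)"
    by (rule integral_mult_right_zero)
  also have "(\<integral>y. \<alpha> / Gamma (1 - \<alpha>) * y powr (- \<alpha> - 1) * (f y / y) \<partial>?M) = (\<integral>y. f y / y \<partial>n_I \<alpha>)"
    unfolding n_I_def using \<alpha> G by (subst integral_density) auto
  finally show "(\<integral>y. f y \<partial>n_B \<alpha>) = (\<alpha> + 1) / \<alpha> * (\<integral>y. f y / y \<partial>n_I \<alpha>)" .
qed

text \<open>Relative to \<open>n_I\<close> there is an extra factor 1 / y. The first factor of the
  product absorbs it, being at most r y, and the second is integrable against
  \<open>n_I\<close>.\<close>

lemma integrable_n_B_exp: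
  assumes "0 \<le> r" "0 \<le> s"
  shows "integrable (n_B \<alpha>) (\<lambda>y. (1 - exp (- r * y)) * (1 - exp (- s * y)))"
proof (subst integrable_n_B_iff)
  have [measurable]: "(\<lambda>y. y) \<in> borel_measurable (n_I \<alpha>)"
    by (auto intro: borel_measurable_cong_restrict)
  show "integrable (n_I \<alpha>) (\<lambda>y. (1 - exp (- r * y)) * (1 - exp (- s * y)) / y)"
  proof (rule Bochner_Integration.integrable_bound)
    show "integrable (n_I \<alpha>) (\<lambda>y. r * (1 - exp (- s * y)))"
      using has_bochner_integral_n_I_exp[OF \<alpha> assms(2)]
      by (intro integrable_mult_right) (auto simp: has_bochner_integral_iff)
    show "AE y in n_I \<alpha>. norm ((1 - exp (- r * y)) * (1 - exp (- s * y)) / y) \<le> norm (r * (1 - exp (- s * y)))"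
    proof (intro AE_I2)
      fix y assume "y \<in> space (n_I \<alpha>)"
      then have y: "y > 0" by simp
      have "(1 - exp (- r * y)) * (1 - exp (- s * y)) \<le> (r * y) * (1 - exp (- s * y))"
        using exp_ge_add_one_self[of "- r * y"] assms y by (intro mult_right_mono) auto
      then have "(1 - exp (- r * y)) * (1 - exp (- s * y)) / y \<le> r * (1 - exp (- s * y))"
        using y by (simp add: field_simps)
      moreover have "0 \<le> (1 - exp (- r * y)) * (1 - exp (- s * y)) / y"
        using assms y by (intro divide_nonneg_nonneg mult_nonneg_nonneg) auto
      ultimately show "norm ((1 - exp (- r * y)) * (1 - exp (- s * y)) / y) \<le> norm (r * (1 - exp (- s * y)))"
        by simp
    qed
  qed measurable
qed (rule borel_measurable_cong_restrict[OF refl], measurable)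

text \<open>The identity \<open>point\<close>, integrated first against \<open>n_I\<close> and then
  against \<Lambda>, expresses the terms in D through the increments of g and the defect of g^2;
  since g^2 is balanced, the latter integrates to the difference of its integrals under
  \<open>n_I\<close> and \<Lambda>.\<close>

lemma energy_identity:
  assumes meas: "g \<in> borel_measurable borel"
    and bal: "balanced (\<lambda>z. (g z)\<^sup>2)"
    and E: "iterated_integrable \<Lambda> (n_B \<alpha>) (\<lambda>z. z) (\<lambda>z y. (g (z + y) - g z)\<^sup>2)"
  shows
    "iterated_integrable \<Lambda> (n_B \<alpha>) (\<lambda>z. z ^ 3) (\<lambda>z y. (g z / z - g (z + y) / (z + y))\<^sup>2)" (is ?B)
    "iterated_integrable \<Lambda> (n_I \<alpha>) (\<lambda>z. z\<^sup>2) (\<lambda>z y. (g z / z - g (z + y) / (z + y))\<^sup>2)" (is ?I)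
    "(\<integral>z. z * (\<integral>y. (g (z + y) - g z)\<^sup>2 \<partial>n_B \<alpha>) \<partial>\<Lambda>) + (\<integral>y. (g y)\<^sup>2 \<partial>n_I \<alpha>) - (\<integral>z. (g z)\<^sup>2 \<partial>\<Lambda>) =
      \<alpha> / (\<alpha> + 1) * (\<integral>z. z ^ 3 * (\<integral>y. (g z / z - g (z + y) / (z + y))\<^sup>2 \<partial>n_B \<alpha>) \<partial>\<Lambda>)
      + (\<integral>z. z\<^sup>2 * (\<integral>y. (g z / z - g (z + y) / (z + y))\<^sup>2 \<partial>n_I \<alpha>) \<partial>\<Lambda>)
      + 1 / (\<alpha> + 1) * (\<integral>z. z * (\<integral>y. (g (z + y) - g z)\<^sup>2 \<partial>n_B \<alpha>) \<partial>\<Lambda>)" (is ?eq)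
proof -
  define D where "D z y = (g z / z - g (z + y) / (z + y))\<^sup>2" for z y
  define e where "e z y = (g (z + y) - g z)\<^sup>2" for z y
  define d where "d = defect (\<lambda>z. (g z)\<^sup>2)"
  note sL = sets_log_exponent_measure[OF \<Lambda>] and [simp] = space_log_exponent_measure[OF \<Lambda>]
  note [measurable] = meas
  note [measurable_cong] = sL
  have D0: "D z y \<ge> 0" for z y by (simp add: D_def)
  have id [measurable]: "(\<lambda>y. y) \<in> borel_measurable (n_I \<alpha>)" "(\<lambda>z. z) \<in> borel_measurable \<Lambda>"
    using sL by (auto intro: borel_measurable_cong_restrict)
  have [measurable]: "fst \<in> borel_measurable (\<Lambda> \<Otimes>\<^sub>M n_I \<alpha>)" "snd \<in> borel_measurable (\<Lambda> \<Otimes>\<^sub>M n_I \<alpha>)"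
    using measurable_compose[OF measurable_fst id(2)] measurable_compose[OF measurable_snd id(1)] by auto
  have D2 [measurable]: "(\<lambda>(z, y). D z y) \<in> borel_measurable (\<Lambda> \<Otimes>\<^sub>M n_I \<alpha>)"
    "(\<lambda>(z, y). D z y / y) \<in> borel_measurable (\<Lambda> \<Otimes>\<^sub>M n_I \<alpha>)"
    unfolding D_def by measurable
  have D1: "D z \<in> borel_measurable borel" "e z \<in> borel_measurable borel" for z
    unfolding D_def[abs_def] e_def[abs_def] by measurable
  have Dm [measurable]: "D z \<in> borel_measurable (restrict_space borel {0<..})" "D z \<in> borel_measurable (n_I \<alpha>)"
    "e z \<in> borel_measurable (restrict_space borel {0<..})" for z
    using D1 by (auto intro: borel_measurable_cong_restrict)
  \<comment> \<open>With w = z + y both sides equal (w / y) (g(z) - (z / w) g(w))^2.\<close>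
  have point: "z\<^sup>2 * D z y + z ^ 3 * (D z y / y) = z * (e z y / y) + d z y" if "z > 0" "y > 0" for z y
  proof -
    have "z + y > 0" using that by simp
    define w where "w = z + y"
    have w: "w > 0" "y = w - z" using that by (auto simp: w_def)
    have "w - z \<noteq> 0" using that w by auto
    with that(1) w(1) show ?thesis
      unfolding D_def e_def d_def defect_def w_def[symmetric] unfolding w(2)
      by (simp add: divide_simps power2_eq_square power3_eq_cube) (simp add: algebra_simps)
  qed
  have int_e: "integrable (n_I \<alpha>) (\<lambda>y. e z y / y)" if "z > 0" for z
    using E that integrable_n_B_iff[OF Dm(3)] by (auto simp: iterated_integrable_def e_def[abs_def])
  have int_d: "integrable (n_I \<alpha>) (d z)" if "z > 0" for z
    using bal that by (auto simp: balanced_def d_def)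
  have int_sum: "integrable (n_I \<alpha>) (\<lambda>y. z\<^sup>2 * D z y + z ^ 3 * (D z y / y))" if z: "z > 0" for z
    using int_e[OF z] int_d[OF z] by (subst Bochner_Integration.integrable_cong[OF refl point[OF z]]) (auto simp del: times_divide_eq_right)
  \<comment> \<open>Both summands on the left of \<open>point\<close> are nonnegative, so each is
    dominated by their sum, which is integrable. The same argument serves for \<Lambda> in
    \<open>I2\<close> and \<open>I3\<close>.\<close>
  have int_D: "integrable (n_I \<alpha>) (D z)" "integrable (n_I \<alpha>) (\<lambda>y. D z y / y)" if z: "z > 0" for z
  proof -
    have "integrable (n_I \<alpha>) (\<lambda>y. z\<^sup>2 * D z y)"
      using int_sum[OF z] by (rule Bochner_Integration.integrable_bound) (use z D0 in \<open>auto intro!: AE_I2\<close>)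
    then show "integrable (n_I \<alpha>) (D z)" using z by simp
    have "integrable (n_I \<alpha>) (\<lambda>y. z ^ 3 * (D z y / y))"
      using int_sum[OF z] by (rule Bochner_Integration.integrable_bound) (use z D0 in \<open>auto intro!: AE_I2\<close>)
    then show "integrable (n_I \<alpha>) (\<lambda>y. D z y / y)" using z by (subst (asm) integrable_mult_left_iff) simp
  qed
  have split: "z\<^sup>2 * (\<integral>y. D z y \<partial>n_I \<alpha>) + z ^ 3 * (\<integral>y. D z y / y \<partial>n_I \<alpha>) =
      \<alpha> / (\<alpha> + 1) * (z * (\<integral>y. e z y \<partial>n_B \<alpha>)) + (\<integral>y. d z y \<partial>n_I \<alpha>)" if z: "z > 0" for z
  proof -
    have "z\<^sup>2 * (\<integral>y. D z y \<partial>n_I \<alpha>) + z ^ 3 * (\<integral>y. D z y / y \<partial>n_I \<alpha>) =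
        (\<integral>y. z\<^sup>2 * D z y + z ^ 3 * (D z y / y) \<partial>n_I \<alpha>)"
      using int_D[OF z] by (subst Bochner_Integration.integral_add) (auto simp del: times_divide_eq_right)
    also have "\<dots> = (\<integral>y. z * (e z y / y) + d z y \<partial>n_I \<alpha>)"
      by (intro Bochner_Integration.integral_cong refl point z) simp
    also have "\<dots> = z * (\<integral>y. e z y / y \<partial>n_I \<alpha>) + (\<integral>y. d z y \<partial>n_I \<alpha>)"
      using int_e[OF z] int_d[OF z]
      by (subst Bochner_Integration.integral_add) (auto simp del: times_divide_eq_right)
    also have "z * (\<integral>y. e z y / y \<partial>n_I \<alpha>) = \<alpha> / (\<alpha> + 1) * (z * (\<integral>y. e z y \<partial>n_B \<alpha>))"
      using \<alpha> by (subst integral_n_B[OF Dm(3)]) (simp add: divide_simps)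
    finally show ?thesis .
  qed
  have Lam: "integrable \<Lambda> (\<lambda>z. \<alpha> / (\<alpha> + 1) * (z * (\<integral>y. e z y \<partial>n_B \<alpha>)))" "integrable \<Lambda> (\<lambda>z. \<integral>y. d z y \<partial>n_I \<alpha>)"
    using E bal by (auto simp: iterated_integrable_def e_def balanced_def d_def)
  have sumL: "integrable \<Lambda> (\<lambda>z. z\<^sup>2 * (\<integral>y. D z y \<partial>n_I \<alpha>) + z ^ 3 * (\<integral>y. D z y / y \<partial>n_I \<alpha>))"
    using Lam by (subst Bochner_Integration.integrable_cong[OF refl split]) (auto simp del: times_divide_eq_right)
  have nonneg: "0 \<le> (\<integral>y. D z y \<partial>n_I \<alpha>)" "0 \<le> (\<integral>y. D z y / y \<partial>n_I \<alpha>)" for z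
    using D0 by (auto intro!: integral_nonneg_AE AE_I2)
  have I2: "integrable \<Lambda> (\<lambda>z. z\<^sup>2 * (\<integral>y. D z y \<partial>n_I \<alpha>))"
    using sumL by (rule Bochner_Integration.integrable_bound) (use nonneg in \<open>auto intro!: AE_I2\<close>)
  have I3: "integrable \<Lambda> (\<lambda>z. z ^ 3 * (\<integral>y. D z y / y \<partial>n_I \<alpha>))"
    using sumL by (rule Bochner_Integration.integrable_bound) (use nonneg in \<open>auto intro!: AE_I2\<close>)
  have nB: "z ^ 3 * (\<integral>y. D z y \<partial>n_B \<alpha>) = (\<alpha> + 1) / \<alpha> * (z ^ 3 * (\<integral>y. D z y / y \<partial>n_I \<alpha>))" for z
    by (subst integral_n_B[OF Dm(1)]) simp
  have "integrable (n_B \<alpha>) (D z)" if "z > 0" for z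
    using int_D(2)[OF that] integrable_n_B_iff[OF Dm(1)] by simp
  then show ?B
    unfolding iterated_integrable_def D_def[symmetric] nB
    using I3 by (auto simp del: times_divide_eq_right)
  show ?I
    unfolding iterated_integrable_def D_def[symmetric]
    using I2 int_D(1) by auto
  have "(\<integral>z. z\<^sup>2 * (\<integral>y. D z y \<partial>n_I \<alpha>) \<partial>\<Lambda>) + (\<integral>z. z ^ 3 * (\<integral>y. D z y / y \<partial>n_I \<alpha>) \<partial>\<Lambda>) =
      (\<integral>z. z\<^sup>2 * (\<integral>y. D z y \<partial>n_I \<alpha>) + z ^ 3 * (\<integral>y. D z y / y \<partial>n_I \<alpha>) \<partial>\<Lambda>)"
    using I2 I3 by (intro Bochner_Integration.integral_add[symmetric])
  also have "\<dots> = (\<integral>z. \<alpha> / (\<alpha> + 1) * (z * (\<integral>y. e z y \<partial>n_B \<alpha>)) + (\<integral>y. d z y \<partial>n_I \<alpha>) \<partial>\<Lambda>)"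
    by (intro Bochner_Integration.integral_cong refl split) simp
  also have "\<dots> = \<alpha> / (\<alpha> + 1) * (\<integral>z. z * (\<integral>y. e z y \<partial>n_B \<alpha>) \<partial>\<Lambda>) + (\<integral>z. (\<integral>y. d z y \<partial>n_I \<alpha>) \<partial>\<Lambda>)"
    using Lam by (subst Bochner_Integration.integral_add) (auto simp del: times_divide_eq_right)
  also have "(\<integral>z. (\<integral>y. d z y \<partial>n_I \<alpha>) \<partial>\<Lambda>) = (\<integral>y. (g y)\<^sup>2 \<partial>n_I \<alpha>) - (\<integral>z. (g z)\<^sup>2 \<partial>\<Lambda>)"
    using bal by (simp add: balanced_def d_def)
  finally have main: "(\<integral>z. z\<^sup>2 * (\<integral>y. D z y \<partial>n_I \<alpha>) \<partial>\<Lambda>) + (\<integral>z. z ^ 3 * (\<integral>y. D z y / y \<partial>n_I \<alpha>) \<partial>\<Lambda>) =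
    \<alpha> / (\<alpha> + 1) * (\<integral>z. z * (\<integral>y. e z y \<partial>n_B \<alpha>) \<partial>\<Lambda>) + ((\<integral>y. (g y)\<^sup>2 \<partial>n_I \<alpha>) - (\<integral>z. (g z)\<^sup>2 \<partial>\<Lambda>))" .
  have "\<alpha> / (\<alpha> + 1) * (\<integral>z. z ^ 3 * (\<integral>y. D z y \<partial>n_B \<alpha>) \<partial>\<Lambda>) = (\<integral>z. z ^ 3 * (\<integral>y. D z y / y \<partial>n_I \<alpha>) \<partial>\<Lambda>)"
    unfolding nB integral_mult_right_zero using \<alpha> by simp
  \<comment> \<open>Conversion to \<open>n_I\<close> left only the share \<alpha> / (\<alpha> + 1)
    of the increment energy in \<open>main\<close>; the remaining share 1 / (\<alpha> + 1) is the
    third term of the claim.\<close>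
  moreover have "x = \<alpha> / (\<alpha> + 1) * x + 1 / (\<alpha> + 1) * x" for x
  proof -
    have "x = (\<alpha> / (\<alpha> + 1) + 1 / (\<alpha> + 1)) * x"
      using \<alpha> by (simp add: add_divide_distrib[symmetric])
    then show ?thesis by (simp only: distrib_right)
  qed
  moreover have "i + n - u = p + a + w" if "a + b = v + (n - u)" "p = b" "i = v + w"
    for a b i n p u v w :: real
    using that by linarith
  ultimately show ?eq
    unfolding D_def[symmetric] e_def[symmetric] using main by blast
qed

text \<open>Each exponential contributes exp (- r z) (1 - exp (- r y)) to the increment, so its
  square is a finite sum of products separating z from y. The y-factors are integrable against
  \<open>n_B\<close>, the weighted z-factors z exp (- (r + s) z) against \<Lambda>.\<close>

lemma iterated_integrable_exp_increment:
  assumes "finite L" "L \<subseteq> {0<..}" and g: "\<And>z. g z = (\<Sum>r\<in>L. c r * (1 - exp (- r * z)))"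
  shows "iterated_integrable \<Lambda> (n_B \<alpha>) (\<lambda>z. z) (\<lambda>z y. (g (z + y) - g z)\<^sup>2)"
proof -
  let ?p = "\<lambda>r s y. (1 - exp (- r * y)) * (1 - exp (- s * y))"
  have inc: "g (z + y) - g z = (\<Sum>r\<in>L. c r * exp (- r * z) * (1 - exp (- r * y)))" for z y
    unfolding g sum_subtractf[symmetric]
    by (intro sum.cong refl) (simp add: algebra_simps exp_add[symmetric])
  have exp2: "exp (- (r + s) * z) = exp (- r * z) * exp (- s * z)" for r s z :: real
    by (simp add: exp_add[symmetric] ring_distribs)
  have sq: "(g (z + y) - g z)\<^sup>2 =
      (\<Sum>r\<in>L. \<Sum>s\<in>L. c r * c s * exp (- (r + s) * z) * ?p r s y)" for z y
    unfolding inc power2_eq_square sum_product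
    by (intro sum.cong refl) (simp only: exp2, simp only: mult_ac)
  have p: "integrable (n_B \<alpha>) (?p r s)" if "r \<in> L" "s \<in> L" for r s
    using that assms by (intro integrable_n_B_exp) (auto intro: less_imp_le)
  have int: "integrable (n_B \<alpha>) (\<lambda>y. \<Sum>s\<in>L. c r * c s * exp (- (r + s) * z) * ?p r s y)" if "r \<in> L" for r z
    using that by (intro Bochner_Integration.integrable_sum integrable_mult_right p)
  have inner: "z * (\<integral>y. (g (z + y) - g z)\<^sup>2 \<partial>n_B \<alpha>) =
      (\<Sum>r\<in>L. \<Sum>s\<in>L. c r * c s * (\<integral>y. ?p r s y \<partial>n_B \<alpha>) * (z * exp (- (r + s) * z)))" for z
  proof -
    have "(\<integral>y. (g (z + y) - g z)\<^sup>2 \<partial>n_B \<alpha>) =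
        (\<Sum>r\<in>L. \<integral>y. (\<Sum>s\<in>L. c r * c s * exp (- (r + s) * z) * ?p r s y) \<partial>n_B \<alpha>)"
      unfolding sq by (rule Bochner_Integration.integral_sum[OF int])
    also have "\<dots> = (\<Sum>r\<in>L. \<Sum>s\<in>L. \<integral>y. c r * c s * exp (- (r + s) * z) * ?p r s y \<partial>n_B \<alpha>)"
      by (intro sum.cong refl Bochner_Integration.integral_sum integrable_mult_right p)
    finally show ?thesis
      unfolding integral_mult_right_zero by (simp only: sum_distrib_left mult_ac)
  qed
  have "integrable \<Lambda> (\<lambda>z. z * exp (- (r + s) * z))" if "r \<in> L" "s \<in> L" for r s
    using has_bochner_integral_mult_exp[OF \<Lambda>, of "r + s"] that assms
    by (auto simp: has_bochner_integral_iff subset_iff intro: add_pos_pos)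
  then show ?thesis
    unfolding iterated_integrable_def inner unfolding sq
    using int by (auto intro!: Bochner_Integration.integrable_sum integrable_mult_right simp del: mult_minus_left)
qed

text \<open>The product of 1 - exp (- r z) and 1 - exp (- s z) is their sum minus 1 - exp (- (r + s)
  z). Hence squares stay in the span of the functions already known to be balanced.\<close>

lemma balanced_exp_sum_square:
  assumes "L \<subseteq> {0<..}" and g: "\<And>z. g z = (\<Sum>r\<in>L. c r * (1 - exp (- r * z)))"
  shows "balanced (\<lambda>z. (g z)\<^sup>2)"
proof -
  have sq: "(g z)\<^sup>2 = (\<Sum>r\<in>L. \<Sum>s\<in>L. c r * c s *
      ((1 - exp (- r * z)) + ((1 - exp (- s * z)) + (- 1) * (1 - exp (- (r + s) * z)))))" for z
    unfolding g power2_eq_square sum_product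
    by (intro sum.cong refl) (simp add: algebra_simps exp_add[symmetric])
  have "0 \<le> r" if "r \<in> L" for r
    using that assms(1) by (auto intro: less_imp_le)
  then show ?thesis
    unfolding sq
    by (intro balanced_sum balanced_cmult balanced_add balanced_one_minus_exp add_nonneg_nonneg)
qed

end

section \<open>Transfer to F and conclusion\<close>

lemma iterated_integrable_cong:
  assumes "\<And>z y. z \<in> space M \<Longrightarrow> y \<in> space N \<Longrightarrow> f z y = g z y"
  shows "iterated_integrable M N w f \<longleftrightarrow> iterated_integrable M N w g"
proof -
  have "(\<forall>z\<in>space M. integrable N (f z)) \<longleftrightarrow> (\<forall>z\<in>space M. integrable N (g z))"
    using assms by (intro ball_cong refl Bochner_Integration.integrable_cong)
  moreover have "integrable M (\<lambda>z. w z * (\<integral>y. f z y \<partial>N)) \<longleftrightarrow> integrable M (\<lambda>z. w z * (\<integral>y. g z y \<partial>N))"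
    using assms
    by (intro Bochner_Integration.integrable_cong Bochner_Integration.integral_cong refl
        arg_cong2[where f = "(*)"])
  ultimately show ?thesis
    by (simp only: iterated_integrable_def)
qed

theorem theorem4p2:
  fixes \<alpha> :: real and \<Lambda> :: "real measure" and F :: "real \<Rightarrow> real"
  assumes "0 < \<alpha>" and "\<alpha> < 1"
    and "log_exponent_measure \<alpha> \<Lambda>"
    and "F \<in> exp_span"
  shows
    "integrable \<Lambda> (\<lambda>z. (F z - F 0)\<^sup>2) \<and>
     integrable (n_I \<alpha>) (\<lambda>y. (F y - F 0)\<^sup>2) \<and>
     iterated_integrable \<Lambda> (n_B \<alpha>) (\<lambda>z. z) (\<lambda>z y. (F (z + y) - F z)\<^sup>2) \<and>
     iterated_integrable \<Lambda> (n_B \<alpha>) (\<lambda>z. z ^ 3)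
       (\<lambda>z y. ((F z - F 0) / z - (F (z + y) - F 0) / (z + y))\<^sup>2) \<and>
     iterated_integrable \<Lambda> (n_I \<alpha>) (\<lambda>z. z\<^sup>2)
       (\<lambda>z y. ((F z - F 0) / z - (F (z + y) - F 0) / (z + y))\<^sup>2) \<and>
     2 * V_form \<alpha> \<Lambda> F - U_form \<Lambda> F =
       \<alpha> / (\<alpha> + 1) * (\<integral>z. z ^ 3 *
         (\<integral>y. ((F z - F 0) / z - (F (z + y) - F 0) / (z + y))\<^sup>2 \<partial>n_B \<alpha>) \<partial>\<Lambda>)
       + (\<integral>z. z\<^sup>2 *
         (\<integral>y. ((F z - F 0) / z - (F (z + y) - F 0) / (z + y))\<^sup>2 \<partial>n_I \<alpha>) \<partial>\<Lambda>)
       + 1 / (\<alpha> + 1) * (\<integral>z. z * (\<integral>y. (F (z + y) - F z)\<^sup>2 \<partial>n_B \<alpha>) \<partial>\<Lambda>) \<and>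
     U_form \<Lambda> F \<le> 2 * V_form \<alpha> \<Lambda> F \<and>
     (\<integral>z. (F z - F 0)\<^sup>2 \<partial>\<Lambda>) \<le>
       (\<integral>z. z * (\<integral>y. (F (z + y) - F z)\<^sup>2 \<partial>n_B \<alpha>) \<partial>\<Lambda>) + (\<integral>y. (F y - F 0)\<^sup>2 \<partial>n_I \<alpha>)"
proof -
  note \<alpha> = assms(1,2) and \<Lambda> = assms(3)
  note [simp] = space_log_exponent_measure[OF \<Lambda>]
  obtain L c where L: "finite L" "L \<subseteq> {0<..}" and F: "\<And>z. 0 \<le> z \<Longrightarrow> F z = (\<Sum>r\<in>L. c r * exp (- r * z))"
    using assms(4) by (auto simp: exp_span_def)
  \<comment> \<open>On [0, \<infinity>) this is F(0) - F, and the sign disappears in the squares. F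
    is arbitrary on the negative half-line, whereas g is an exponential sum everywhere and therefore
    Borel.\<close>
  define g where "g z = (\<Sum>r\<in>L. c r * (1 - exp (- r * z)))" for z
  have Fg: "F z - F 0 = - g z" if "0 \<le> z" for z
    using that by (simp add: F g_def sum_subtractf right_diff_distrib)
  have sq: "(F z - F 0)\<^sup>2 = (g z)\<^sup>2"
    and sqE: "(F (z + y) - F z)\<^sup>2 = (g (z + y) - g z)\<^sup>2"
    and sqD: "((F z - F 0) / z - (F (z + y) - F 0) / (z + y))\<^sup>2 = (g z / z - g (z + y) / (z + y))\<^sup>2"
    if "0 < z" "0 < y" for z y
  proof -
    have z: "F z - F 0 = - g z" and zy: "F (z + y) - F 0 = - g (z + y)"
      using that by (simp_all add: Fg)
    show "(F z - F 0)\<^sup>2 = (g z)\<^sup>2"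
      unfolding z by simp
    have "F (z + y) - F z = - (g (z + y) - g z)"
      using z zy by linarith
    then show "(F (z + y) - F z)\<^sup>2 = (g (z + y) - g z)\<^sup>2"
      by (simp only: power2_minus)
    have "(F z - F 0) / z - (F (z + y) - F 0) / (z + y) = - (g z / z - g (z + y) / (z + y))"
      unfolding z zy by simp
    then show "((F z - F 0) / z - (F (z + y) - F 0) / (z + y))\<^sup>2 = (g z / z - g (z + y) / (z + y))\<^sup>2"
      by (simp only: power2_minus)
  qed
  have meas: "g \<in> borel_measurable borel"
    unfolding g_def[abs_def] by measurable
  note bal = balanced_exp_sum_square[OF \<alpha> \<Lambda> L(2) g_def]
  note E = iterated_integrable_exp_increment[OF \<alpha> \<Lambda> L g_def]
  note energy = energy_identity[OF \<alpha> \<Lambda> meas bal E]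
  have int: "integrable \<Lambda> (\<lambda>z. (g z)\<^sup>2)" "integrable (n_I \<alpha>) (\<lambda>z. (g z)\<^sup>2)"
    using bal by (auto simp: balanced_def[OF \<alpha> \<Lambda>])
  \<comment> \<open>The fact \<open>sq\<close> shares its hypotheses with the two-variable facts, so
    \<open>zero_less_one\<close> instantiates the idle variable y by 1.\<close>
  have cong:
    "integrable \<Lambda> (\<lambda>z. (F z - F 0)\<^sup>2) \<longleftrightarrow> integrable \<Lambda> (\<lambda>z. (g z)\<^sup>2)"
    "integrable (n_I \<alpha>) (\<lambda>z. (F z - F 0)\<^sup>2) \<longleftrightarrow> integrable (n_I \<alpha>) (\<lambda>z. (g z)\<^sup>2)"
    "(\<integral>z. (F z - F 0)\<^sup>2 \<partial>\<Lambda>) = (\<integral>z. (g z)\<^sup>2 \<partial>\<Lambda>)"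
    "(\<integral>z. (F z - F 0)\<^sup>2 \<partial>n_I \<alpha>) = (\<integral>z. (g z)\<^sup>2 \<partial>n_I \<alpha>)"
    by (intro Bochner_Integration.integrable_cong Bochner_Integration.integral_cong refl
        sq[OF _ zero_less_one]; simp)+
  have cong2:
    "iterated_integrable \<Lambda> (n_B \<alpha>) w (\<lambda>z y. (F (z + y) - F z)\<^sup>2) \<longleftrightarrow>
     iterated_integrable \<Lambda> (n_B \<alpha>) w (\<lambda>z y. (g (z + y) - g z)\<^sup>2)"
    "iterated_integrable \<Lambda> (n_B \<alpha>) w (\<lambda>z y. ((F z - F 0) / z - (F (z + y) - F 0) / (z + y))\<^sup>2) \<longleftrightarrow>
     iterated_integrable \<Lambda> (n_B \<alpha>) w (\<lambda>z y. (g z / z - g (z + y) / (z + y))\<^sup>2)"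
    "iterated_integrable \<Lambda> (n_I \<alpha>) w (\<lambda>z y. ((F z - F 0) / z - (F (z + y) - F 0) / (z + y))\<^sup>2) \<longleftrightarrow>
     iterated_integrable \<Lambda> (n_I \<alpha>) w (\<lambda>z y. (g z / z - g (z + y) / (z + y))\<^sup>2)" for w
    by (intro iterated_integrable_cong sqE sqD; simp)+
  have cong3:
    "(\<integral>z. z * (\<integral>y. (F (z + y) - F z)\<^sup>2 \<partial>n_B \<alpha>) \<partial>\<Lambda>) = (\<integral>z. z * (\<integral>y. (g (z + y) - g z)\<^sup>2 \<partial>n_B \<alpha>) \<partial>\<Lambda>)"
    "(\<integral>z. z ^ 3 * (\<integral>y. ((F z - F 0) / z - (F (z + y) - F 0) / (z + y))\<^sup>2 \<partial>n_B \<alpha>) \<partial>\<Lambda>) =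
     (\<integral>z. z ^ 3 * (\<integral>y. (g z / z - g (z + y) / (z + y))\<^sup>2 \<partial>n_B \<alpha>) \<partial>\<Lambda>)"
    "(\<integral>z. z\<^sup>2 * (\<integral>y. ((F z - F 0) / z - (F (z + y) - F 0) / (z + y))\<^sup>2 \<partial>n_I \<alpha>) \<partial>\<Lambda>) =
     (\<integral>z. z\<^sup>2 * (\<integral>y. (g z / z - g (z + y) / (z + y))\<^sup>2 \<partial>n_I \<alpha>) \<partial>\<Lambda>)"
    by (intro Bochner_Integration.integral_cong refl arg_cong2[where f = "(*)"] sqE sqD; simp)+
  have V: "2 * V_form \<alpha> \<Lambda> F =
      (\<integral>z. z * (\<integral>y. (g (z + y) - g z)\<^sup>2 \<partial>n_B \<alpha>) \<partial>\<Lambda>) + (\<integral>y. (g y)\<^sup>2 \<partial>n_I \<alpha>)"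
    by (simp add: V_form_def cong cong3)
  have U: "U_form \<Lambda> F = (\<integral>z. (g z)\<^sup>2 \<partial>\<Lambda>)"
    by (simp add: U_form_def cong)
  \<comment> \<open>The inequality follows because every term on the right of the identity is an
    integral of squares with nonnegative weights on (0, \<infinity>).\<close>
  have "0 \<le> \<alpha> / (\<alpha> + 1) * (\<integral>z. z ^ 3 * (\<integral>y. (g z / z - g (z + y) / (z + y))\<^sup>2 \<partial>n_B \<alpha>) \<partial>\<Lambda>)
      + (\<integral>z. z\<^sup>2 * (\<integral>y. (g z / z - g (z + y) / (z + y))\<^sup>2 \<partial>n_I \<alpha>) \<partial>\<Lambda>)
      + 1 / (\<alpha> + 1) * (\<integral>z. z * (\<integral>y. (g (z + y) - g z)\<^sup>2 \<partial>n_B \<alpha>) \<partial>\<Lambda>)"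
    using \<alpha> by (intro add_nonneg_nonneg mult_nonneg_nonneg integral_nonneg_AE AE_I2) auto
  then have "(\<integral>z. (g z)\<^sup>2 \<partial>\<Lambda>) \<le>
      (\<integral>z. z * (\<integral>y. (g (z + y) - g z)\<^sup>2 \<partial>n_B \<alpha>) \<partial>\<Lambda>) + (\<integral>y. (g y)\<^sup>2 \<partial>n_I \<alpha>)"
    using energy(3) by linarith
  then show ?thesis
    unfolding cong cong2 cong3 V U by (intro conjI int E energy)
qed

end
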